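(* There exist a finite dimensional complex Hilbert space $H$ and a unital contractive representation $\pi:\mathscr{A}\to B(H)$ which is not completely contractive. In fact, there exists a $2\times 2$ matrix rational inner function $F\in M_2(\mathscr{A})$ (with poles outside of the closed unit disk) such that $\|F\|\le 1$, but $\|\pi^{(2)}(F)\|>1$.
   Context: $\mathbb D$ is the open unit disk in $\mathbb C$. The disk algebra $\mathbb A(\mathbb D)$ is the closure of the analytic polynomials in $C(\overline{\mathbb D})$ with the supremum norm. The Neil algebra is $\mathscr{A}=\{f\in\mathbb A(\mathbb D): f'(0)=0\}=\mathbb C+z^2\mathbb A(\mathbb D)$, with the supremum norm. $B(H)$ is the algebra of bounded linear operators on $H$. A unital representation (unital algebra homomorphism) $\pi:\mathscr{A}\to B(H)$ is contractive if $\|\pi(f)\|\le\|f\|$ for all $f\in\mathscr{A}$. For $F=(f_{j,\ell})\in M_n(\mathscr{A})$, $\|F\|=\sup\{\|F(z)\|: z\in\mathbb D\}$, where $\|F(z)\|$ is the operator norm of the $n\times n$ matrix $F(z)$, and $\pi^{(n)}(F)=(\pi(f_{j,\ell}))_{j,\ell}$, acting on $\bigoplus_1^n H$. The representation $\pi$ is completely contractive if $\|\pi^{(n)}(F)\|\le\|F\|$ for all $n$ and all $F\in M_n(\mathscr{A})$. A rational matrix function, with poles off the closed disk, is inner if it takes unitary values on the unit circle. *)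

theory Defs
  imports
    "HOL-Analysis.Complex_Analysis_Basics"
    "HOL-Analysis.L2_Norm"
    "Jordan_Normal_Form.Schur_Decomposition"
begin

text \<open>
  A function on the closed unit disk is represented by a total function that is
  \<^const>\<open>extensional\<close> on the disk, so that equality of representatives is equality of
  functions on the closed disk.
\<close>

abbreviation closed_disk :: "complex set" where
  "closed_disk \<equiv> cball 0 1"

definition disk_algebra :: "(complex \<Rightarrow> complex) set" where
  "disk_algebra = {f \<in> extensional closed_disk.
     \<exists>p :: nat \<Rightarrow> complex poly. uniform_limit closed_disk (\<lambda>n z. poly (p n) z) f sequentially}"

definition neil_algebra :: "(complex \<Rightarrow> complex) set" where
  "neil_algebra = {f \<in> disk_algebra. deriv f 0 = 0}"

definition sup_norm :: "(complex \<Rightarrow> complex) \<Rightarrow> real" where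
  "sup_norm f = (SUP z\<in>closed_disk. cmod (f z))"


definition l2_norm :: "complex vec \<Rightarrow> real" where
  "l2_norm v = L2_set (\<lambda>i. cmod (vec_index v i)) {..<dim_vec v}"

definition op_norm :: "complex mat \<Rightarrow> real" where
  "op_norm A = (SUP v\<in>{v \<in> carrier_vec (dim_col A). l2_norm v \<le> 1}. l2_norm (mult_mat_vec A v))"

definition unitary_mat :: "complex mat \<Rightarrow> bool" where
  "unitary_mat U \<longleftrightarrow> square_mat U \<and>
     mat_adjoint U * U = 1\<^sub>m (dim_row U) \<and> U * mat_adjoint U = 1\<^sub>m (dim_row U)"


text \<open>
  The finite dimensional Hilbert space of dimension \<open>d\<close> is \<open>\<complex>\<^sup>d\<close>, whose bounded
  operators are the \<open>d \<times> d\<close> matrices.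
\<close>

definition unital_representation :: "nat \<Rightarrow> ((complex \<Rightarrow> complex) \<Rightarrow> complex mat) \<Rightarrow> bool" where
  "unital_representation d \<pi> \<longleftrightarrow>
     (\<forall>f\<in>neil_algebra. \<pi> f \<in> carrier_mat d d) \<and>
     \<pi> (\<lambda>z\<in>closed_disk. 1) = 1\<^sub>m d \<and>
     (\<forall>f\<in>neil_algebra. \<forall>g\<in>neil_algebra. \<pi> (\<lambda>z\<in>closed_disk. f z + g z) = \<pi> f + \<pi> g) \<and>
     (\<forall>c. \<forall>f\<in>neil_algebra. \<pi> (\<lambda>z\<in>closed_disk. c * f z) = c \<cdot>\<^sub>m \<pi> f) \<and>
     (\<forall>f\<in>neil_algebra. \<forall>g\<in>neil_algebra. \<pi> (\<lambda>z\<in>closed_disk. f z * g z) = \<pi> f * \<pi> g)"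

definition contractive :: "((complex \<Rightarrow> complex) \<Rightarrow> complex mat) \<Rightarrow> bool" where
  "contractive \<pi> \<longleftrightarrow> (\<forall>f\<in>neil_algebra. op_norm (\<pi> f) \<le> sup_norm f)"


definition neil_mats :: "nat \<Rightarrow> (complex \<Rightarrow> complex) mat set" where
  "neil_mats n = {F \<in> carrier_mat n n. \<forall>j<n. \<forall>l<n. F $$ (j, l) \<in> neil_algebra}"

definition mat_at :: "(complex \<Rightarrow> complex) mat \<Rightarrow> complex \<Rightarrow> complex mat" where
  "mat_at F z = map_mat (\<lambda>f. f z) F"

definition mat_sup_norm :: "(complex \<Rightarrow> complex) mat \<Rightarrow> real" where
  "mat_sup_norm F = (SUP z\<in>ball 0 1. op_norm (mat_at F z))"

text \<open>
  The direct sum of \<open>n\<close> copies of \<open>\<complex>\<^sup>d\<close> is identified with \<open>\<complex>\<^sup>n\<^sup>d\<close>, coordinate \<open>k\<close> of the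
  \<open>j\<close>-th summand being coordinate \<open>j * d + k\<close>.
\<close>

definition ampliation ::
  "nat \<Rightarrow> nat \<Rightarrow> ((complex \<Rightarrow> complex) \<Rightarrow> complex mat) \<Rightarrow> (complex \<Rightarrow> complex) mat \<Rightarrow> complex mat" where
  "ampliation d n \<pi> F =
     mat (n * d) (n * d) (\<lambda>(r, s). \<pi> (F $$ (r div d, s div d)) $$ (r mod d, s mod d))"

definition completely_contractive ::
  "nat \<Rightarrow> ((complex \<Rightarrow> complex) \<Rightarrow> complex mat) \<Rightarrow> bool" where
  "completely_contractive d \<pi> \<longleftrightarrow>
     (\<forall>n. \<forall>F\<in>neil_mats n. op_norm (ampliation d n \<pi> F) \<le> mat_sup_norm F)"


definition rational_mat :: "(complex \<Rightarrow> complex) mat \<Rightarrow> bool" where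
  "rational_mat F \<longleftrightarrow> (\<forall>j<dim_row F. \<forall>l<dim_col F. \<exists>p q :: complex poly.
     \<forall>z\<in>closed_disk. poly q z \<noteq> 0 \<and> (F $$ (j, l)) z = poly p z / poly q z)"

definition rational_inner :: "(complex \<Rightarrow> complex) mat \<Rightarrow> bool" where
  "rational_inner F \<longleftrightarrow> rational_mat F \<and> (\<forall>z\<in>sphere 0 1. unitary_mat (mat_at F z))"

end

theory Submission
  imports Defs "HOL-Complex_Analysis.Complex_Analysis"
begin

text \<open>
  Write \<open>f = f\<^sub>0 + f\<^sub>2 z\<^sup>2 + f\<^sub>3 z\<^sup>3 + \<dots>\<close> for a function in the Neil algebra. As there is no linear
  term, \<open>f\<^sub>2\<close> and \<open>f\<^sub>3\<close> are point derivations at \<open>0\<close>, so for any two matrices \<open>A\<close>, \<open>B\<close> the block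
  matrices \<open>\<pi>(f) = (f\<^sub>0, f\<^sub>2 A + f\<^sub>3 B; 0, f\<^sub>0)\<close> define a unital representation. The pair \<open>A\<close>, \<open>B\<close> is
  chosen so that the constraint on scalar coefficients is satisfied and the constraint on
  matrix coefficients is violated.

  Contractivity: for \<open>f\<close> in the unit ball, a Moebius transformation of the values reduces to
  \<open>f\<^sub>0 = 0\<close>. Then \<open>f = z\<^sup>2 k\<close> with \<open>k\<close> in the unit ball of \<open>H\<^sup>\<infinity>\<close>, and the pairs
  \<open>(f\<^sub>2, f\<^sub>3) = (k 0, k' 0)\<close> that arise are those with \<open>\<bar>f\<^sub>3\<bar> \<le> 1 - \<bar>f\<^sub>2\<bar>\<^sup>2\<close>
  (\<open>taylor_coeffs_of_neil_function\<close>). So \<open>\<pi>\<close> is contractive once \<open>f\<^sub>2 A + f\<^sub>3 B\<close> is a contraction for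
  all these pairs, and \<open>A = (1, 0; 0, 0)\<close>, \<open>B = (0, 1; 1/2, 0)\<close> have this property
  (\<open>coupling_contraction\<close>).

  Failure of complete contractivity: matrix coefficients have more freedom, because two
  different singular values of \<open>F\<^sub>2\<close> can be linked through \<open>F\<^sub>3\<close>. The coefficients
  \<open>F\<^sub>2 = diag(3/5, 0)\<close>, \<open>F\<^sub>3 = (0, 4/5; 4/5, 0)\<close> belong to a polynomial inner function, and
  \<open>F\<^sub>2 \<otimes> A + F\<^sub>3 \<otimes> B\<close> contains the block \<open>(3/5, 4/5; 2/5, 0)\<close>. Its first row is a unit vector that is
  not orthogonal to the second row, so its norm exceeds \<open>1\<close>
  (\<open>op_norm_ampliation_neil_inner\<close>).
\<close>

section \<open>Schwarz--Pick at the origin\<close>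

text \<open>
  This is the maximum principle in the form that divides a function of the unit ball of
  \<open>H\<^sup>\<infinity>\<close> by the coordinate. The Schwarz lemma asks for a strict bound, so it is applied to
  the multiples by \<open>t < 1\<close>, and \<open>t\<close> is sent to \<open>1\<close> at the end.
\<close>

lemma norm_le_1_if_norm_mult_id_le_1:
  fixes k :: "complex \<Rightarrow> complex"
  assumes hol: "k holomorphic_on ball 0 1"
    and le: "\<And>z. z \<in> ball 0 1 \<Longrightarrow> cmod (z * k z) \<le> 1"
    and z: "z \<in> ball 0 1"
  shows "cmod (k z) \<le> 1"
proof (rule field_le_mult_one_interval)
  fix t :: real
  assume t: "0 < t" "t < 1"
  define g where "g = (\<lambda>w. of_real t * (w * k w))"
  have g_hol: "g holomorphic_on ball 0 1"
    unfolding g_def by (intro holomorphic_intros hol)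
  have g_0: "g 0 = 0"
    by (simp add: g_def)
  have g_lt: "cmod (g w) < 1" if "cmod w < 1" for w
  proof -
    have "cmod (g w) \<le> t * 1"
      unfolding g_def norm_mult[of "of_real t"] using t le[of w] that
      by (intro mult_mono) auto
    then show ?thesis
      using t by simp
  qed
  show "t * cmod (k z) \<le> 1"
  proof (cases "z = 0")
    case False
    have "cmod (g z) \<le> cmod z"
      using Schwarz_Lemma(1)[OF g_hol g_0 g_lt] z by simp
    then show ?thesis
      using False t by (simp add: g_def norm_mult)
  next
    case True
    have "(k has_field_derivative deriv k 0) (at 0)"
      using hol by (intro holomorphic_derivI[of k "ball 0 1"]) auto
    then have "(g has_field_derivative of_real t * k 0) (at 0)"
      unfolding g_def by (auto intro!: derivative_eq_intros)
    then have "deriv g 0 = of_real t * k 0"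
      by (rule DERIV_imp_deriv)
    moreover have "cmod (deriv g 0) \<le> 1"
      using Schwarz_Lemma(2)[OF g_hol g_0 g_lt, of 0] by simp
    ultimately show ?thesis
      using True t by (simp add: norm_mult)
  qed
qed

text \<open>
  Composing with the automorphism of the disk that moves \<open>k 0\<close> to \<open>0\<close> reduces this to the
  Schwarz lemma; the derivative of that automorphism at \<open>k 0\<close> is \<open>1 / (1 - \<bar>k 0\<bar>\<^sup>2)\<close>.
\<close>

lemma Schwarz_Pick_at_0:
  assumes hol: "k holomorphic_on ball 0 1"
    and le: "\<And>z. z \<in> ball 0 1 \<Longrightarrow> cmod (k z) \<le> 1"
  shows "cmod (deriv k 0) \<le> 1 - (cmod (k 0))\<^sup>2"
proof -
  have "cmod (deriv k 0) + (cmod (k 0))\<^sup>2 \<le> 1"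
  proof (rule field_le_mult_one_interval)
    fix s :: real
    assume s: "0 < s" "s < 1"
    \<comment> \<open>Scaling \<open>k\<close> by \<open>t\<close> multiplies the two terms by \<open>t\<close> and \<open>t\<^sup>2\<close>; with \<open>t\<^sup>2 = s \<le> t\<close> both
      are at least their multiples by \<open>s\<close>.\<close>
    define t where "t = sqrt s"
    have t: "0 < t" "t < 1" "t\<^sup>2 = s" "s \<le> t"
      using s unfolding t_def by (auto simp: real_le_rsqrt power2_eq_square mult_left_le)
    define a where "a = of_real t * k 0"
    define g where "g = (\<lambda>w. of_real t * k w)"
    have g_lt: "cmod (g w) < 1" if "cmod w < 1" for w
    proof -
      have "cmod (g w) \<le> t * 1"
        unfolding g_def norm_mult using t le[of w] that
        by (intro mult_mono) auto
      then show ?thesis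
        using t by simp
    qed
    have a: "cmod a < 1" "g 0 = a"
      using g_lt[of 0] by (auto simp: g_def a_def)
    define m where "m = (\<lambda>w. Moebius_function 0 a (g w))"
    have "g holomorphic_on ball 0 1"
      unfolding g_def by (intro holomorphic_intros hol)
    then have m_hol: "m holomorphic_on ball 0 1"
      unfolding m_def using g_lt
      by (intro holomorphic_on_compose_gen[of g _ "Moebius_function 0 a" "ball 0 1", unfolded o_def]
          Moebius_function_holomorphic[OF a(1)]) auto
    have "cmod (deriv m 0) \<le> 1"
    proof (rule Schwarz_Lemma(2)[where \<xi> = 0, OF m_hol])
      show "m 0 = 0"
        by (simp add: m_def a Moebius_function_eq_zero)
      show "cmod (m w) < 1" if "cmod w < 1" for w
        unfolding m_def by (rule Moebius_function_norm_lt_1[OF a(1) g_lt[OF that]])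
    qed simp
    moreover have "deriv m 0 = of_real t * deriv k 0 / (1 - cnj a * a)"
    proof (rule DERIV_imp_deriv)
      have "(k has_field_derivative deriv k 0) (at 0)"
        using hol by (intro holomorphic_derivI[of k "ball 0 1"]) auto
      then have g: "(g has_field_derivative of_real t * deriv k 0) (at 0)"
        unfolding g_def by (auto intro!: derivative_eq_intros)
      have nz: "1 - cnj a * a \<noteq> 0"
        using a(1) by (metis complex_mod_cnj mult_less_cancel_right1 norm_eq_zero norm_mult norm_one
            not_less_iff_gr_or_eq order_less_le_trans right_minus_eq norm_ge_zero mult_le_one less_eq_real_def)
      show "(m has_field_derivative of_real t * deriv k 0 / (1 - cnj a * a)) (at 0)"
        unfolding m_def Moebius_function_simple
        by (rule derivative_eq_intros g refl | use nz a in \<open>simp; fail\<close>)+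
    qed
    moreover have "cmod (1 - cnj a * a) = 1 - s * (cmod (k 0))\<^sup>2"
    proof -
      have "1 - cnj a * a = of_real (1 - (cmod a)\<^sup>2)"
        using complex_norm_square[of a] by (simp add: mult.commute)
      moreover have "(cmod a)\<^sup>2 \<le> 1"
        using a by (simp add: power_le_one)
      ultimately have "cmod (1 - cnj a * a) = 1 - (cmod a)\<^sup>2"
        by (metis abs_of_nonneg diff_ge_0_iff_ge norm_of_real)
      then show ?thesis
        using t by (simp add: a_def norm_mult power_mult_distrib)
    qed
    moreover have "1 - s * (cmod (k 0))\<^sup>2 > 0"
    proof -
      have "s * (cmod (k 0))\<^sup>2 \<le> s * 1"
        using s le[of 0] by (intro mult_left_mono) (auto simp: power_le_one)
      then show ?thesis using s by linarith
    qed
    ultimately have "t * cmod (deriv k 0) \<le> 1 - s * (cmod (k 0))\<^sup>2"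
      using t by (simp add: norm_divide norm_mult)
    moreover have "s * cmod (deriv k 0) \<le> t * cmod (deriv k 0)"
      using t by (intro mult_right_mono) auto
    ultimately show "s * (cmod (deriv k 0) + (cmod (k 0))\<^sup>2) \<le> 1"
      by (simp add: algebra_simps)
  qed
  then show ?thesis by simp
qed

section \<open>Taylor coefficients of functions in the Neil algebra\<close>

definition taylor_coeff :: "nat \<Rightarrow> (complex \<Rightarrow> complex) \<Rightarrow> complex" where
  "taylor_coeff n f = fps_nth (fps_expansion f 0) n"

lemma taylor_coeff_eq: "f has_fps_expansion F \<Longrightarrow> taylor_coeff n f = fps_nth F n"
  by (simp add: taylor_coeff_def fps_expansion_eqI)

lemma taylor_coeff_0: "taylor_coeff 0 f = f 0"
  by (simp add: taylor_coeff_def fps_expansion_def)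

text \<open>
  This is one step of the Schur algorithm, adapted to functions without linear term. With
  \<open>a = f 0\<close>, the function \<open>(f - a) / (1 - \<^bold>a f)\<close>, where \<open>\<^bold>a\<close> is the conjugate of \<open>a\<close>, is bounded
  by \<open>1\<close> and vanishes to second order at \<open>0\<close>, so it equals \<open>z\<^sup>2 k\<close> with \<open>k\<close> bounded by \<open>1\<close>.
  The scalars \<open>k0\<close>, \<open>k1\<close> are the first two Taylor coefficients of \<open>k\<close>, and Schwarz--Pick for
  \<open>k\<close> is the inequality between them. Solving for \<open>f\<close> gives
  \<open>f = a + (1 - \<bar>a\<bar>\<^sup>2) z\<^sup>2 k + O(z\<^sup>4)\<close>.
\<close>

lemma taylor_coeffs_of_neil_function:
  assumes hol: "f holomorphic_on ball 0 1"
    and lt: "\<And>z. z \<in> ball 0 1 \<Longrightarrow> cmod (f z) < 1"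
    and deriv_0: "deriv f 0 = 0"
  obtains k0 k1 :: complex where
    "taylor_coeff 2 f = (1 - (cmod (f 0))\<^sup>2) * k0"
    "taylor_coeff 3 f = (1 - (cmod (f 0))\<^sup>2) * k1"
    "cmod k1 \<le> 1 - (cmod k0)\<^sup>2"
proof -
  define a where "a = f 0"
  have a: "cmod a < 1"
    using lt[of 0] by (simp add: a_def)
  obtain e1 where e1: "e1 holomorphic_on ball 0 1" "\<And>z. cmod z < 1 \<Longrightarrow> f z - a = z * e1 z"
    "deriv (\<lambda>z. f z - a) 0 = e1 0"
    by (rule Schwarz3[of "\<lambda>z. f z - a" 1]) (use hol in \<open>auto simp: a_def intro!: holomorphic_intros\<close>)
  have "e1 0 = 0"
  proof -
    have "(f has_field_derivative 0) (at 0)"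
      using hol deriv_0 holomorphic_derivI[of f "ball 0 1" 0] by auto
    then have "((\<lambda>z. f z - a) has_field_derivative 0) (at 0)"
      by (auto intro!: derivative_eq_intros)
    then show ?thesis
      using e1(3) DERIV_imp_deriv by force
  qed
  then obtain e where e: "e holomorphic_on ball 0 1" "\<And>z. cmod z < 1 \<Longrightarrow> e1 z = z * e z"
    using Schwarz3[OF e1(1)] by metis
  have f_eq: "f z = a + z^2 * e z" if "cmod z < 1" for z
    using e1(2)[OF that] e(2)[OF that] by (simp add: power2_eq_square algebra_simps)
  have nz: "1 - cnj a * f z \<noteq> 0" if "cmod z < 1" for z
  proof -
    have "cmod (cnj a * f z) < 1"
      using a lt[of z] that by (simp add: norm_mult) (smt (verit) mult_le_one norm_ge_zero mult_less_cancel_left2 mult_left_le)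
    then show ?thesis by force
  qed
  \<comment> \<open>Defining \<open>k\<close> through \<open>e\<close>, where \<open>f = a + z\<^sup>2 e\<close>, makes it holomorphic at \<open>0\<close> as well.\<close>
  define k where "k = (\<lambda>z. e z / (1 - cnj a * f z))"
  have k_hol: "k holomorphic_on ball 0 1"
    unfolding k_def using nz by (intro holomorphic_intros e hol) auto
  have zzk: "cmod (z * (z * k z)) \<le> 1" if "z \<in> ball 0 1" for z
  proof -
    have "z * (z * k z) = Moebius_function 0 a (f z)"
      using that f_eq[of z] by (simp add: Moebius_function_simple k_def power2_eq_square)
    then show ?thesis
      using Moebius_function_norm_lt_1[OF a lt[OF that], of 0] by simp
  qed
  have k_le: "cmod (k z) \<le> 1" if "z \<in> ball 0 1" for z
  proof (rule norm_le_1_if_norm_mult_id_le_1[OF k_hol _ that])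
    fix w :: complex
    assume "w \<in> ball 0 1"
    then show "cmod (w * k w) \<le> 1"
      by (intro norm_le_1_if_norm_mult_id_le_1[of "\<lambda>w. w * k w"])
         (auto intro!: holomorphic_intros k_hol zzk)
  qed
  define E where "E = fps_expansion e 0"
  define K where "K = fps_expansion k 0"
  have E: "e has_fps_expansion E" and K: "k has_fps_expansion K"
    unfolding E_def K_def using e(1) k_hol
    by (auto intro!: has_fps_expansion_fps_expansion[of "ball 0 1"])
  have ev: "\<forall>\<^sub>F z in nhds 0. cmod z < (1::real)"
    using eventually_nhds_in_open[of "ball 0 1" "0::complex"] by simp
  have F: "f has_fps_expansion (fps_const a + fps_X ^ 2 * E)"
  proof -
    have "(\<lambda>z. a + z^2 * e z) has_fps_expansion (fps_const a + fps_X ^ 2 * E)"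
      by (intro fps_expansion_intros E)
    moreover have "\<forall>\<^sub>F z in nhds 0. f z = a + z^2 * e z"
      using ev by eventually_elim (rule f_eq)
    ultimately show ?thesis
      by (simp add: has_fps_expansion_cong)
  qed
  have "E = K * (1 - fps_const (cnj a) * (fps_const a + fps_X ^ 2 * E))"
  proof (rule fps_expansion_unique_complex[OF E])
    have "(\<lambda>z. k z * (1 - cnj a * f z)) has_fps_expansion
        (K * (1 - fps_const (cnj a) * (fps_const a + fps_X ^ 2 * E)))"
      by (intro fps_expansion_intros K F)
    moreover have "\<forall>\<^sub>F z in nhds 0. e z = k z * (1 - cnj a * f z)"
      using ev by eventually_elim (use nz in \<open>auto simp: k_def nonzero_eq_divide_eq\<close>)
    ultimately show "e has_fps_expansion (K * (1 - fps_const (cnj a) * (fps_const a + fps_X ^ 2 * E)))"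
      by (simp add: has_fps_expansion_cong)
  qed
  then have E_nth: "fps_nth E n = fps_nth (K * (1 - fps_const (cnj a) * (fps_const a + fps_X ^ 2 * E))) n" for n
    by simp
  have "a * cnj a = (of_real (cmod a))\<^sup>2"
    using complex_norm_square[of a] by simp
  with E_nth[of 0] E_nth[of 1] have E01:
    "fps_nth E 0 = (1 - (cmod a)\<^sup>2) * fps_nth K 0" "fps_nth E 1 = (1 - (cmod a)\<^sup>2) * fps_nth K 1"
    by (simp_all add: fps_mult_nth mult.commute fps_X_power_mult_nth)
  show thesis
  proof (rule that)
    show "taylor_coeff 2 f = (1 - (cmod (f 0))\<^sup>2) * fps_nth K 0"
      "taylor_coeff 3 f = (1 - (cmod (f 0))\<^sup>2) * fps_nth K 1"
      using E01 by (simp_all add: taylor_coeff_eq[OF F] a_def[symmetric] fps_X_power_mult_nth)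
    have "fps_nth K 0 = k 0" "fps_nth K 1 = deriv k 0"
      by (simp_all add: K_def fps_expansion_def)
    then show "cmod (fps_nth K 1) \<le> 1 - (cmod (fps_nth K 0))\<^sup>2"
      using Schwarz_Pick_at_0[OF k_hol k_le] by simp
  qed
qed

lemma disk_algebraD:
  assumes "f \<in> disk_algebra"
  shows "continuous_on closed_disk f" "f holomorphic_on ball 0 1"
proof -
  obtain p :: "nat \<Rightarrow> complex poly"
    where p: "uniform_limit closed_disk (\<lambda>n z. poly (p n) z) f sequentially"
    using assms by (auto simp: disk_algebra_def)
  have "\<forall>\<^sub>F n in sequentially. continuous_on closed_disk (poly (p n)) \<and> poly (p n) holomorphic_on ball 0 1"
    by (intro always_eventually allI conjI continuous_intros holomorphic_intros)
  from holomorphic_uniform_limit[OF this p] 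
  show "continuous_on closed_disk f" "f holomorphic_on ball 0 1"
    by (auto simp: trivial_limit_sequentially)
qed

lemma norm_le_sup_norm:
  assumes "f \<in> disk_algebra" "z \<in> closed_disk"
  shows "cmod (f z) \<le> sup_norm f"
  unfolding sup_norm_def
proof (rule cSUP_upper[OF assms(2)])
  have "compact ((\<lambda>z. cmod (f z)) ` closed_disk)"
    by (intro compact_continuous_image continuous_intros disk_algebraD assms compact_cball)
  then show "bdd_above ((\<lambda>z. cmod (f z)) ` closed_disk)"
    by (intro bounded_imp_bdd_above compact_imp_bounded)
qed

lemma disk_algebra_has_fps_expansion:
  assumes "f \<in> disk_algebra"
  shows "f has_fps_expansion fps_expansion f 0"
  by (rule has_fps_expansion_fps_expansion[of "ball 0 1"]) (use disk_algebraD[OF assms] in auto)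

lemma has_fps_expansion_restrict_closed_disk:
  assumes "f has_fps_expansion F"
  shows "restrict f closed_disk has_fps_expansion F"
proof -
  have "\<forall>\<^sub>F z in nhds 0. z \<in> ball 0 (1::real)"
    by (rule eventually_nhds_in_open) auto
  then have "\<forall>\<^sub>F z in nhds 0. restrict f closed_disk z = f z"
    by eventually_elim auto
  then show ?thesis
    using assms by (simp add: has_fps_expansion_cong)
qed

section \<open>The operator norm of a matrix\<close>

lemma l2_norm_conv_sqrt: "l2_norm v = sqrt (\<Sum>i<dim_vec v. (cmod (vec_index v i))\<^sup>2)"
  by (simp add: l2_norm_def L2_set_def)

lemma l2_norm_smult: "l2_norm (c \<cdot>\<^sub>v u) = cmod c * l2_norm u"
  unfolding l2_norm_def L2_set_right_distrib[OF norm_ge_zero]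
  by (rule L2_set_cong) (auto simp: norm_mult)

lemma op_norm_leI:
  assumes "M \<ge> 0"
    and le: "\<And>v. v \<in> carrier_vec (dim_col A) \<Longrightarrow> l2_norm (A *\<^sub>v v) \<le> M * l2_norm v"
  shows "op_norm A \<le> M"
  unfolding op_norm_def
proof (rule cSUP_least)
  have "0\<^sub>v (dim_col A) \<in> {v \<in> carrier_vec (dim_col A). l2_norm v \<le> 1}"
    by (simp add: l2_norm_conv_sqrt)
  then show "{v \<in> carrier_vec (dim_col A). l2_norm v \<le> 1} \<noteq> {}"
    by blast
next
  fix v assume v: "v \<in> {v \<in> carrier_vec (dim_col A). l2_norm v \<le> 1}"
  then have "l2_norm (A *\<^sub>v v) \<le> M * l2_norm v"
    by (intro le) simp
  also have "\<dots> \<le> M * 1"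
    using v \<open>M \<ge> 0\<close> by (intro mult_left_mono) auto
  finally show "l2_norm (A *\<^sub>v v) \<le> M" by simp
qed

lemma norm_vec_index_le_l2_norm: "i < dim_vec v \<Longrightarrow> cmod (vec_index v i) \<le> l2_norm v"
  unfolding l2_norm_def by (rule member_le_L2_set) auto

text \<open>
  The operator norm is a supremum of reals, so using it as an upper bound needs a bound for
  the whole set; the sum of the moduli of all entries is one.
\<close>

lemma l2_norm_mult_le_op_norm:
  assumes "v \<in> carrier_vec (dim_col A)" "l2_norm v \<le> 1"
  shows "l2_norm (A *\<^sub>v v) \<le> op_norm A"
  unfolding op_norm_def
proof (rule cSUP_upper)
  show "bdd_above ((\<lambda>v. l2_norm (A *\<^sub>v v)) ` {v \<in> carrier_vec (dim_col A). l2_norm v \<le> 1})"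
  proof (rule bdd_aboveI2)
    fix w assume w: "w \<in> {v \<in> carrier_vec (dim_col A). l2_norm v \<le> 1}"
    have "l2_norm (A *\<^sub>v w) \<le> (\<Sum>i<dim_row A. cmod (vec_index (A *\<^sub>v w) i))"
      unfolding l2_norm_def by (simp add: L2_set_le_sum del: index_mult_mat_vec)
    also have "\<dots> \<le> (\<Sum>i<dim_row A. \<Sum>j<dim_col A. cmod (A $$ (i, j)))"
    proof (rule sum_mono)
      fix i assume i: "i \<in> {..<dim_row A}"
      have "vec_index (A *\<^sub>v w) i = (\<Sum>j<dim_col A. A $$ (i, j) * vec_index w j)"
        using i w by (auto simp: scalar_prod_def atLeast0LessThan)
      also have "cmod \<dots> \<le> (\<Sum>j<dim_col A. cmod (A $$ (i, j)) * 1)"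
      proof (rule sum_norm_le)
        fix j assume "j \<in> {..<dim_col A}"
        then have "cmod (vec_index w j) \<le> 1"
          using w norm_vec_index_le_l2_norm[of j w] by auto
        then show "cmod (A $$ (i, j) * vec_index w j) \<le> cmod (A $$ (i, j)) * 1"
          unfolding norm_mult by (rule mult_left_mono) simp
      qed
      finally show "cmod (vec_index (A *\<^sub>v w) i) \<le> (\<Sum>j<dim_col A. cmod (A $$ (i, j)))"
        by simp
    qed
    finally show "l2_norm (A *\<^sub>v w) \<le> (\<Sum>i<dim_row A. \<Sum>j<dim_col A. cmod (A $$ (i, j)))" .
  qed
qed (use assms in auto)

section \<open>The representation\<close>

text \<open>
  In \<open>2 \<times> 2\<close> blocks this is \<open>(a, X; 0, a)\<close> with \<open>X = b A + c B\<close>, where \<open>A = (1, 0; 0, 0)\<close> and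
  \<open>B = (0, 1; 1/2, 0)\<close>.
\<close>

definition jet_mat :: "complex \<Rightarrow> complex \<Rightarrow> complex \<Rightarrow> complex mat" where
  "jet_mat a b c = mat 4 4 (\<lambda>(i, j).
     [[a, 0, b, c], [0, a, c / 2, 0], [0, 0, a, 0], [0, 0, 0, a]] ! i ! j)"

lemma dim_jet_mat [simp]: "dim_row (jet_mat a b c) = 4" "dim_col (jet_mat a b c) = 4"
  by (simp_all add: jet_mat_def)

lemma jet_mat_index [simp]:
  "i < 4 \<Longrightarrow> j < 4 \<Longrightarrow> jet_mat a b c $$ (i, j) =
    [[a, 0, b, c], [0, a, c / 2, 0], [0, 0, a, 0], [0, 0, 0, a]] ! i ! j"
  by (simp add: jet_mat_def)

lemma all_less_4: "(\<forall>i<4. P i) \<longleftrightarrow> P 0 \<and> P (Suc 0) \<and> P 2 \<and> P (3::nat)"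
  by (auto simp: numeral_nat less_Suc_eq)

lemma sum_less_4: "(\<Sum>i<4. h i) = h 0 + h (Suc 0) + h 2 + h (3::nat)"
  for h :: "nat \<Rightarrow> 'b::comm_monoid_add"
  by (simp add: numeral_nat)

lemma mat_4_eqI:
  assumes "dim_row A = 4" "dim_col A = 4" "dim_row B = 4" "dim_col B = 4"
    and "\<forall>i<4. \<forall>j<4. A $$ (i, j) = B $$ (i, j)"
  shows "A = B"
  using assms by (intro eq_matI) auto

lemma jet_mat_one: "jet_mat 1 0 0 = 1\<^sub>m 4"
  by (rule mat_4_eqI) (simp_all add: all_less_4)

lemma jet_mat_add: "jet_mat (a + a') (b + b') (c + c') = jet_mat a b c + jet_mat a' b' c'"
  by (rule mat_4_eqI) (simp_all add: all_less_4 add_divide_distrib)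

lemma jet_mat_smult: "jet_mat (s * a) (s * b) (s * c) = s \<cdot>\<^sub>m jet_mat a b c"
  by (rule mat_4_eqI) (simp_all add: all_less_4)

text \<open>
  The product rule is that of Taylor polynomials \<open>a + b z\<^sup>2 + c z\<^sup>3\<close> modulo \<open>z\<^sup>4\<close>.
\<close>

lemma jet_mat_mult:
  "jet_mat (a * a') (a * b' + b * a') (a * c' + c * a') = jet_mat a b c * jet_mat a' b' c'"
  by (rule mat_4_eqI)
     (simp_all add: all_less_4 scalar_prod_def atLeast0LessThan sum_less_4 field_simps)

text \<open>
  With \<open>r = \<bar>a\<bar>\<close> and \<open>s = 1 - r\<^sup>2\<close> this is the Cauchy--Schwarz inequality for
  \<open>r \<cdot> \<bar>p\<bar> + \<surd>s \<cdot> (\<surd>s \<bar>y\<bar>)\<close>. It makes the block matrix \<open>(a, s Y; 0, a)\<close> a contraction whenever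
  \<open>Y\<close> is one, as one expects from the von Neumann inequality for the nilpotent contraction
  \<open>(0, Y; 0, 0)\<close> and the function \<open>(z + a) / (1 + \<^bold>a z)\<close>, \<open>\<^bold>a\<close> being the conjugate of \<open>a\<close>.
\<close>

lemma norm_sq_mult_add_le:
  fixes a p y :: complex
  assumes "cmod a \<le> 1"
  shows "(cmod (a * p + of_real (1 - (cmod a)\<^sup>2) * y))\<^sup>2 \<le> (cmod p)\<^sup>2 + (1 - (cmod a)\<^sup>2) * (cmod y)\<^sup>2"
proof -
  define r s P Y where "r = cmod a" and "s = 1 - (cmod a)\<^sup>2" and "P = cmod p" and "Y = cmod y"
  have s: "s = 1 - r^2" "s \<ge> 0"
    using assms by (auto simp: s_def r_def power_le_one)
  have "cmod (a * p + of_real s * y) \<le> r * P + s * Y"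
    using norm_triangle_ineq[of "a * p" "of_real s * y"] s(2)
    by (simp add: norm_mult r_def P_def Y_def)
  then have "(cmod (a * p + of_real s * y))\<^sup>2 \<le> (r * P + s * Y)\<^sup>2"
    by (intro power_mono) auto
  also have "\<dots> = P\<^sup>2 + s * Y\<^sup>2 - s * (P - r * Y)\<^sup>2"
    unfolding s(1) by (simp add: power2_eq_square algebra_simps)
  also have "\<dots> \<le> P\<^sup>2 + s * Y\<^sup>2"
    using s by simp
  finally show ?thesis
    by (simp add: s_def P_def Y_def)
qed

text \<open>
  The matrix \<open>k A + l B = (k, l; l/2, 0)\<close> is a contraction for all \<open>k\<close>, \<open>l\<close> that occur as the
  first two Taylor coefficients of a scalar function bounded by \<open>1\<close>. The entry \<open>1/2\<close> leaves
  room: the same holds with any number up to \<open>1/\<surd>2\<close> in its place, and any nonzero number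
  makes the representation fail to be completely contractive.
\<close>

lemma coupling_contraction:
  fixes k l x w :: complex
  assumes "cmod l \<le> 1 - (cmod k)\<^sup>2"
  shows "(cmod (k * x + l * w))\<^sup>2 + (cmod (l / 2 * x))\<^sup>2 \<le> (cmod x)\<^sup>2 + (cmod w)\<^sup>2"
proof -
  define r s X W where "r = cmod k" and "s = 1 - (cmod k)\<^sup>2" and "X = cmod x" and "W = cmod w"
  have r: "0 \<le> r" "r \<le> 1"
    using assms order_trans[OF norm_ge_zero assms] by (auto simp: r_def power2_le_iff_abs_le abs_square_le_1)
  have s: "s = 1 - r^2" "s \<ge> 0" "s \<le> 1"
    using assms order_trans[OF norm_ge_zero assms] by (auto simp: s_def r_def)
  have "cmod (k * x + l * w) \<le> r * X + s * W"
    using norm_triangle_ineq[of "k * x" "l * w"] mult_right_mono[OF assms, of W]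
    by (simp add: norm_mult r_def s_def X_def W_def)
  then have "(cmod (k * x + l * w))\<^sup>2 \<le> (r * X + s * W)\<^sup>2"
    by (intro power_mono) auto
  moreover have "(cmod (l / 2 * x))\<^sup>2 \<le> (s / 2 * X)\<^sup>2"
    using assms by (intro power_mono) (auto simp: norm_mult norm_divide s_def X_def intro!: mult_right_mono)
  \<comment> \<open>Since \<open>1 - s = r\<^sup>2\<close>, the difference is a quadratic form in \<open>X\<close> and \<open>r W\<close>. Setting aside
    \<open>s (1 - s) / 4 \<cdot> X\<^sup>2\<close> leaves \<open>3 s / 4\<close> as the coefficient of \<open>X\<^sup>2\<close>, for which the square is
    completed.\<close>
  moreover have "X\<^sup>2 + W\<^sup>2 - (r * X + s * W)\<^sup>2 - (s / 2 * X)\<^sup>2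
      = 3 / 4 * s * (X - 4 / 3 * r * W)\<^sup>2 + s * (1 - s) / 4 * X\<^sup>2 + (1 - s / 3) * (r * W)\<^sup>2"
    unfolding s(1) by (simp add: power2_eq_square field_simps)
  moreover have "\<dots> \<ge> 0"
    using s(2,3) by (intro add_nonneg_nonneg mult_nonneg_nonneg) auto
  ultimately show ?thesis
    by (simp add: X_def W_def)
qed

definition neil_rep :: "(complex \<Rightarrow> complex) \<Rightarrow> complex mat" where
  "neil_rep f = jet_mat (taylor_coeff 0 f) (taylor_coeff 2 f) (taylor_coeff 3 f)"

lemma taylor_coeff_1_neil_algebra: "f \<in> neil_algebra \<Longrightarrow> taylor_coeff 1 f = 0"
  by (simp add: neil_algebra_def taylor_coeff_def fps_expansion_def)

lemma unital_representation_neil_rep: "unital_representation 4 neil_rep"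
  unfolding unital_representation_def
proof (intro conjI ballI allI)
  fix f assume f: "f \<in> neil_algebra"
  show "neil_rep f \<in> carrier_mat 4 4"
    by (simp add: neil_rep_def carrier_matI)
  have Df: "f has_fps_expansion fps_expansion f 0"
    using f by (intro disk_algebra_has_fps_expansion) (simp add: neil_algebra_def)
  {
    fix c
    have "taylor_coeff n (\<lambda>z\<in>closed_disk. c * f z) = c * taylor_coeff n f" for n
      by (subst taylor_coeff_eq[OF has_fps_expansion_restrict_closed_disk,
            OF has_fps_expansion_cmult_left[OF Df]]) (simp add: taylor_coeff_def)
    then show "neil_rep (\<lambda>z\<in>closed_disk. c * f z) = c \<cdot>\<^sub>m neil_rep f"
      by (simp add: neil_rep_def jet_mat_smult)
  }
  fix g assume g: "g \<in> neil_algebra"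
  have Dg: "g has_fps_expansion fps_expansion g 0"
    using g by (intro disk_algebra_has_fps_expansion) (simp add: neil_algebra_def)
  have "taylor_coeff n (\<lambda>z\<in>closed_disk. f z + g z) = taylor_coeff n f + taylor_coeff n g" for n
    by (subst taylor_coeff_eq[OF has_fps_expansion_restrict_closed_disk,
          OF has_fps_expansion_add[OF Df Dg]]) (simp add: taylor_coeff_def)
  then show "neil_rep (\<lambda>z\<in>closed_disk. f z + g z) = neil_rep f + neil_rep g"
    by (simp add: neil_rep_def jet_mat_add)
  have "taylor_coeff n (\<lambda>z\<in>closed_disk. f z * g z)
      = (\<Sum>i=0..n. taylor_coeff i f * taylor_coeff (n - i) g)" for n
    by (subst taylor_coeff_eq[OF has_fps_expansion_restrict_closed_disk,
          OF has_fps_expansion_mult[OF Df Dg]]) (simp add: taylor_coeff_def fps_mult_nth)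
  then show "neil_rep (\<lambda>z\<in>closed_disk. f z * g z) = neil_rep f * neil_rep g"
    using taylor_coeff_1_neil_algebra[OF f] taylor_coeff_1_neil_algebra[OF g]
    by (simp add: neil_rep_def numeral_nat flip: jet_mat_mult)
next
  have "taylor_coeff n (\<lambda>z\<in>closed_disk. 1) = (if n = 0 then 1 else 0)" for n
    by (subst taylor_coeff_eq[OF has_fps_expansion_restrict_closed_disk, OF has_fps_expansion_1]) simp
  then show "neil_rep (\<lambda>z\<in>closed_disk. 1) = 1\<^sub>m 4"
    by (simp add: neil_rep_def flip: jet_mat_one)
qed

lemma l2_norm_jet_mat_le:
  assumes k: "cmod l \<le> 1 - (cmod k)\<^sup>2" and a: "cmod a \<le> 1" and v: "v \<in> carrier_vec 4"
  defines "s \<equiv> of_real (1 - (cmod a)\<^sup>2)"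
  shows "l2_norm (jet_mat a (s * k) (s * l) *\<^sub>v v) \<le> l2_norm v"
proof -
  define p q x w where "p = vec_index v 0" and "q = vec_index v 1" and "x = vec_index v 2" and "w = vec_index v 3"
  note defs = p_def q_def x_def w_def
  define y z where "y = k * x + l * w" and "z = l / 2 * x"
  have Av: "\<forall>i<4. vec_index (jet_mat a (s * k) (s * l) *\<^sub>v v) i = [a * p + s * y, a * q + s * z, a * x, a * w] ! i"
    using v by (simp add: all_less_4 scalar_prod_def atLeast0LessThan sum_less_4 defs y_def z_def algebra_simps)
  have "(cmod (a * p + s * y))\<^sup>2 \<le> (cmod p)\<^sup>2 + (1 - (cmod a)\<^sup>2) * (cmod y)\<^sup>2"
    "(cmod (a * q + s * z))\<^sup>2 \<le> (cmod q)\<^sup>2 + (1 - (cmod a)\<^sup>2) * (cmod z)\<^sup>2"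
    unfolding s_def by (rule norm_sq_mult_add_le[OF a])+
  moreover have "(1 - (cmod a)\<^sup>2) * ((cmod y)\<^sup>2 + (cmod z)\<^sup>2) \<le> (1 - (cmod a)\<^sup>2) * ((cmod x)\<^sup>2 + (cmod w)\<^sup>2)"
    unfolding y_def z_def using a
    by (intro mult_left_mono coupling_contraction k) (simp add: power_le_one)
  ultimately have "(cmod (a * p + s * y))\<^sup>2 + (cmod (a * q + s * z))\<^sup>2 + (cmod (a * x))\<^sup>2 + (cmod (a * w))\<^sup>2
      \<le> (cmod p)\<^sup>2 + (cmod q)\<^sup>2 + (cmod x)\<^sup>2 + (cmod w)\<^sup>2"
    by (simp add: norm_mult power_mult_distrib algebra_simps)
  then show ?thesis
    using v Av by (simp add: l2_norm_conv_sqrt sum_less_4 all_less_4 defs del: index_mult_mat_vec)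
qed

text \<open>
  The strict bound \<open>\<bar>f\<bar> < 1\<close> in the Schur step excludes unimodular constants. Dividing by any
  number above the supremum norm, rather than by the norm itself, secures it and also covers
  the zero function.
\<close>

lemma contractive_neil_rep: "contractive neil_rep"
  unfolding contractive_def
proof
  fix f assume f: "f \<in> neil_algebra"
  then have fD: "f \<in> disk_algebra" and deriv_f: "deriv f 0 = 0"
    by (auto simp: neil_algebra_def)
  have nonneg: "sup_norm f \<ge> 0"
    by (rule order_trans[OF norm_ge_zero norm_le_sup_norm[OF fD, of 0]]) simp
  show "op_norm (neil_rep f) \<le> sup_norm f"
  proof (rule field_le_epsilon)
    fix e :: real assume "e > 0"
    define M where "M = sup_norm f + e"
    have M: "M > 0" "sup_norm f < M"
      using nonneg \<open>e > 0\<close> by (auto simp: M_def)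
    define g where "g = (\<lambda>z. f z / of_real M)"
    have hol: "g holomorphic_on ball 0 1"
      unfolding g_def using M by (intro holomorphic_intros disk_algebraD[OF fD]) auto
    have lt: "cmod (g z) < 1" if "z \<in> ball 0 1" for z
      using norm_le_sup_norm[OF fD, of z] that M by (simp add: g_def norm_divide)
    have "(f has_field_derivative 0) (at 0)"
      using disk_algebraD(2)[OF fD] deriv_f holomorphic_derivI[of f "ball 0 1" 0] by auto
    then have "(g has_field_derivative 0 / of_real M) (at 0)"
      unfolding g_def by (rule DERIV_cdivide)
    then have deriv_g: "deriv g 0 = 0"
      by (simp add: DERIV_imp_deriv)
    have "(\<lambda>z. of_real M * g z) has_fps_expansion (fps_const (of_real M) * fps_expansion g 0)"
      by (intro has_fps_expansion_cmult_left has_fps_expansion_fps_expansion[of "ball 0 1"] hol) auto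
    moreover have "(\<lambda>z. of_real M * g z) = f"
      using M by (auto simp: g_def)
    ultimately have "f has_fps_expansion (fps_const (of_real M) * fps_expansion g 0)"
      by simp
    then have coeff: "taylor_coeff n f = of_real M * taylor_coeff n g" for n
      by (subst taylor_coeff_eq, assumption) (simp add: taylor_coeff_def)
    obtain k l :: complex where kl:
      "taylor_coeff 2 g = (1 - (cmod (g 0))\<^sup>2) * k"
      "taylor_coeff 3 g = (1 - (cmod (g 0))\<^sup>2) * l"
      "cmod l \<le> 1 - (cmod k)\<^sup>2"
      by (rule taylor_coeffs_of_neil_function[OF hol lt deriv_g])
    have "op_norm (neil_rep f) \<le> M"
    proof (rule op_norm_leI)
      fix v :: "complex Matrix.vec"
      assume "v \<in> carrier_vec (dim_col (neil_rep f))"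
      then have v: "v \<in> carrier_vec 4"
        by (simp add: neil_rep_def)
      define J where "J = jet_mat (taylor_coeff 0 g) (taylor_coeff 2 g) (taylor_coeff 3 g)"
      have J: "J \<in> carrier_mat 4 4"
        by (simp add: J_def carrier_matI)
      have "neil_rep f = of_real M \<cdot>\<^sub>m J"
        unfolding neil_rep_def J_def coeff jet_mat_smult ..
      then have "neil_rep f *\<^sub>v v = of_real M \<cdot>\<^sub>v (J *\<^sub>v v)"
        using J v by (intro eq_vecI) (auto simp: scalar_prod_def sum_distrib_left mult.assoc)
      then have "l2_norm (neil_rep f *\<^sub>v v) = M * l2_norm (J *\<^sub>v v)"
        using M by (simp add: l2_norm_smult)
      also have "l2_norm (J *\<^sub>v v) \<le> l2_norm v"
        unfolding J_def kl(1,2) taylor_coeff_0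
        by (rule l2_norm_jet_mat_le[OF kl(3) _ v]) (use lt[of 0] in simp)
      finally show "l2_norm (neil_rep f *\<^sub>v v) \<le> M * l2_norm v"
        using M by simp
    qed (use M in simp)
    then show "op_norm (neil_rep f) \<le> sup_norm f + e"
      by (simp add: M_def)
  qed
qed

section \<open>The inner function\<close>

definition neil_monomial :: "complex \<Rightarrow> nat \<Rightarrow> complex \<Rightarrow> complex" where
  "neil_monomial c n = (\<lambda>z\<in>closed_disk. c * z ^ n)"

lemma neil_monomial_has_fps_expansion:
  "neil_monomial c n has_fps_expansion fps_const c * fps_X ^ n"
  unfolding neil_monomial_def
  by (intro has_fps_expansion_restrict_closed_disk fps_expansion_intros)

lemma taylor_coeff_neil_monomial: "taylor_coeff m (neil_monomial c n) = (if m = n then c else 0)"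
  by (simp add: taylor_coeff_eq[OF neil_monomial_has_fps_expansion] fps_X_power_nth)

lemma neil_monomial_in_neil_algebra:
  assumes "n \<ge> 2"
  shows "neil_monomial c n \<in> neil_algebra"
proof -
  have "neil_monomial c n \<in> disk_algebra"
    unfolding disk_algebra_def neil_monomial_def
  proof (intro CollectI conjI exI)
    have "uniform_limit closed_disk (\<lambda>_. poly (Polynomial.monom c n)) (poly (Polynomial.monom c n)) sequentially"
      by (rule uniform_limit_const)
    then show "uniform_limit closed_disk (\<lambda>_. poly (Polynomial.monom c n)) (\<lambda>z\<in>closed_disk. c * z ^ n) sequentially"
      by (rule uniform_limit_cong'[THEN iffD1, rotated -1]) (auto simp: poly_monom)
  qed simp
  moreover have "deriv (neil_monomial c n) 0 = taylor_coeff 1 (neil_monomial c n)"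
    by (simp add: taylor_coeff_def fps_expansion_def)
  ultimately show ?thesis
    using assms by (simp add: neil_algebra_def taylor_coeff_neil_monomial)
qed

text \<open>
  This is \<open>z\<^sup>2 D(z) R D(z)\<close> with \<open>D(z) = diag(1, z)\<close> and the reflection
  \<open>R = (3/5, 4/5; 4/5, -3/5)\<close>. The factorization shows that the values are unitary on the circle
  and contractive in the disk.
\<close>

definition neil_inner :: "(complex \<Rightarrow> complex) mat" where
  "neil_inner = mat 2 2 (\<lambda>(i, j). [[neil_monomial (3/5) 2, neil_monomial (4/5) 3], [neil_monomial (4/5) 3, neil_monomial (-3/5) 4]] ! i ! j)"

lemma dim_neil_inner [simp]: "dim_row neil_inner = 2" "dim_col neil_inner = 2"
  by (simp_all add: neil_inner_def)

lemma neil_inner_index: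
  "neil_inner $$ (0, 0) = neil_monomial (3/5) 2" "neil_inner $$ (0, Suc 0) = neil_monomial (4/5) 3"
  "neil_inner $$ (Suc 0, 0) = neil_monomial (4/5) 3" "neil_inner $$ (Suc 0, Suc 0) = neil_monomial (-3/5) 4"
  by (simp_all add: neil_inner_def)

lemma all_less_2: "(\<forall>i<2. P i) \<longleftrightarrow> P 0 \<and> P (Suc 0)"
  by (auto simp: numeral_nat less_Suc_eq)

lemma sum_less_2: "(\<Sum>i<2. h i) = h 0 + h (Suc 0)" for h :: "nat \<Rightarrow> 'b::comm_monoid_add"
  by (simp add: numeral_nat)

lemma mat_2_eqI:
  assumes "dim_row A = 2" "dim_col A = 2" "dim_row B = 2" "dim_col B = 2"
    and "\<forall>i<2. \<forall>j<2. A $$ (i, j) = B $$ (i, j)"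
  shows "A = B"
  using assms by (intro eq_matI) auto

lemma neil_inner_in_neil_mats: "neil_inner \<in> neil_mats 2"
  unfolding neil_mats_def mem_Collect_eq all_less_2 neil_inner_index
  by (intro conjI carrier_matI neil_monomial_in_neil_algebra) simp_all

lemma dim_mat_at [simp]: "dim_row (mat_at F z) = dim_row F" "dim_col (mat_at F z) = dim_col F"
  by (simp_all add: mat_at_def)

lemma mat_at_neil_inner_index:
  assumes "z \<in> closed_disk"
  shows "mat_at neil_inner z $$ (0, 0) = 3/5 * z ^ 2" "mat_at neil_inner z $$ (0, Suc 0) = 4/5 * z ^ 3"
    "mat_at neil_inner z $$ (Suc 0, 0) = 4/5 * z ^ 3" "mat_at neil_inner z $$ (Suc 0, Suc 0) = -3/5 * z ^ 4"
  using assms by (simp_all add: mat_at_def neil_inner_index neil_monomial_def)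

lemma mat_adjoint_index:
  fixes A :: "complex mat"
  assumes "i < dim_col A" "j < dim_row A"
  shows "mat_adjoint A $$ (i, j) = cnj (A $$ (j, i))"
  using assms by (simp add: mat_adjoint_def mat_of_rows_index)

lemma dim_mat_adjoint [simp]:
  "dim_row (mat_adjoint A) = dim_col A" "dim_col (mat_adjoint A) = dim_row A"
  by (simp_all add: mat_adjoint_def)

lemma rational_inner_neil_inner: "rational_inner neil_inner"
  unfolding rational_inner_def
proof (intro conjI ballI)
  have "\<exists>p q. \<forall>z\<in>closed_disk. poly q z \<noteq> 0 \<and> neil_monomial c n z = poly p z / poly q z" for c n
    by (intro exI[of _ "Polynomial.monom c n"] exI[of _ 1]) (auto simp: neil_monomial_def poly_monom)
  then show "rational_mat neil_inner"
    by (simp add: rational_mat_def all_less_2 neil_inner_index)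
next
  fix z :: complex assume z: "z \<in> sphere 0 1"
  then have "z * cnj z = 1"
    using complex_norm_square[of z] by simp
  moreover have nz: "z \<noteq> 0"
    using z by auto
  ultimately have cnj_z: "cnj z = 1 / z"
    by (simp add: nonzero_eq_divide_eq mult.commute)
  have z': "z \<in> closed_disk"
    using z by simp
  define U where "U = mat_at neil_inner z"
  have U: "dim_row U = 2" "dim_col U = 2"
    "U $$ (0, 0) = 3/5 * z ^ 2" "U $$ (0, Suc 0) = 4/5 * z ^ 3"
    "U $$ (Suc 0, 0) = 4/5 * z ^ 3" "U $$ (Suc 0, Suc 0) = -3/5 * z ^ 4"
    using mat_at_neil_inner_index[OF z'] by (simp_all add: U_def)
  have "mat_adjoint U * U = 1\<^sub>m 2" "U * mat_adjoint U = 1\<^sub>m 2"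
    using nz by (intro mat_2_eqI; simp add: U all_less_2 mat_adjoint_index scalar_prod_def
        atLeast0LessThan sum_less_2 cnj_z power2_eq_square power3_eq_cube power4_eq_xxxx)+
  then show "unitary_mat (mat_at neil_inner z)"
    by (simp add: unitary_mat_def U flip: U_def)
qed

lemma reflection_norm_sq:
  fixes x y :: complex
  shows "(cmod (3/5 * x + 4/5 * y))\<^sup>2 + (cmod (4/5 * x - 3/5 * y))\<^sup>2 = (cmod x)\<^sup>2 + (cmod y)\<^sup>2"
  unfolding cmod_power2 by (simp add: power2_eq_square field_simps)

lemma mat_sup_norm_neil_inner_le: "mat_sup_norm neil_inner \<le> 1"
  unfolding mat_sup_norm_def
proof (rule cSUP_least)
  fix z :: complex assume z: "z \<in> ball 0 1"
  then have z': "z \<in> closed_disk" and z1: "cmod z \<le> 1"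
    by auto
  show "op_norm (mat_at neil_inner z) \<le> 1"
  proof (rule op_norm_leI)
    fix v :: "complex Matrix.vec"
    assume "v \<in> carrier_vec (dim_col (mat_at neil_inner z))"
    then have v: "v \<in> carrier_vec 2"
      by simp
    define x w where "x = vec_index v 0" and "w = vec_index v 1"
    define p q where "p = 3/5 * x + 4/5 * (z * w)" and "q = 4/5 * x - 3/5 * (z * w)"
    have Av: "\<forall>i<2. vec_index (mat_at neil_inner z *\<^sub>v v) i = [z ^ 2 * p, z ^ 3 * q] ! i"
      using v
      by (simp add: mat_at_neil_inner_index[OF z'] all_less_2 scalar_prod_def atLeast0LessThan sum_less_2 p_def q_def x_def w_def
          power2_eq_square power3_eq_cube power4_eq_xxxx algebra_simps)
    have "(cmod (z ^ n * u))\<^sup>2 \<le> (cmod u)\<^sup>2" for n u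
      using z1 by (intro power_mono) (auto simp: norm_mult norm_power power_le_one mult_left_le_one_le)
    then have "(cmod (z ^ 2 * p))\<^sup>2 + (cmod (z ^ 3 * q))\<^sup>2 \<le> (cmod p)\<^sup>2 + (cmod q)\<^sup>2"
      by (intro add_mono)
    also have "\<dots> = (cmod x)\<^sup>2 + (cmod (z * w))\<^sup>2"
      unfolding p_def q_def by (rule reflection_norm_sq)
    also have "\<dots> \<le> (cmod x)\<^sup>2 + (cmod w)\<^sup>2"
      using z1 by (intro add_left_mono power_mono) (auto simp: norm_mult mult_left_le_one_le)
    finally show "l2_norm (mat_at neil_inner z *\<^sub>v v) \<le> 1 * l2_norm v"
      using v Av by (simp add: l2_norm_conv_sqrt sum_less_2 all_less_2 x_def w_def del: index_mult_mat_vec)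
  qed simp
qed simp

text \<open>
  The witness is \<open>3/5 e\<^sub>2 + 4/5 e\<^sub>7\<close>: the first coordinate in the lower block of the first copy of
  \<open>\<complex>\<^sup>4\<close> and the second coordinate in the lower block of the second copy. Coordinate \<open>0\<close> of the image
  is \<open>3/5 \<cdot> 3/5 + 4/5 \<cdot> 4/5 = 1\<close>, which already exhausts the norm, while the entry \<open>1/2\<close> of \<open>B\<close>
  adds \<open>6/25\<close> in coordinate \<open>5\<close>.
\<close>

lemma op_norm_ampliation_neil_inner: "op_norm (ampliation 4 2 neil_rep neil_inner) > 1"
proof -
  define A where "A = ampliation 4 2 neil_rep neil_inner"
  define v where "v = vec 8 (\<lambda>s. if s = 2 then 3/5 else if s = 7 then 4/5 else (0::complex))"
  have sum8: "(\<Sum>i<8. h i) = h 0 + h (Suc 0) + h 2 + h 3 + h 4 + h 5 + h 6 + h 7"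
    for h :: "nat \<Rightarrow> 'b::comm_monoid_add"
    by (simp add: eval_nat_numeral)
  have v: "v \<in> carrier_vec (dim_col A)" "l2_norm v = 1"
    by (simp_all add: v_def A_def ampliation_def l2_norm_conv_sqrt sum8 norm_divide power_divide)
  have A: "dim_row A = 8" "A $$ (0, 2) = 3/5" "A $$ (0, 7) = 4/5" "A $$ (5, 2) = 2/5" "A $$ (5, 7) = 0"
    by (simp_all add: A_def ampliation_def neil_rep_def neil_inner_index taylor_coeff_neil_monomial)
  have "vec_index (A *\<^sub>v v) i = A $$ (i, 2) * (3/5) + A $$ (i, 7) * (4/5)" if "i < 8" for i
    using that A(1) v(1) by (simp add: v_def scalar_prod_def atLeast0LessThan sum8)
  from this[of 0] this[of 5] have Av: "vec_index (A *\<^sub>v v) 0 = 1" "vec_index (A *\<^sub>v v) 5 = 6/25"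
    by (simp_all add: A del: index_mult_mat_vec)
  have "(1::real) < sqrt ((cmod 1)\<^sup>2 + (cmod (6/25))\<^sup>2)"
    by (simp add: norm_divide power_divide)
  also have "\<dots> \<le> sqrt (\<Sum>i<8. (cmod (vec_index (A *\<^sub>v v) i))\<^sup>2)"
    unfolding sum8 Av by simp
  also have "\<dots> = l2_norm (A *\<^sub>v v)"
    by (simp add: l2_norm_conv_sqrt A(1))
  also have "\<dots> \<le> op_norm A"
    using v by (intro l2_norm_mult_le_op_norm) auto
  finally show ?thesis
    by (simp add: A_def)
qed

section \<open>A contractive representation that is not completely contractive\<close>

theorem theorem1p1:
  shows "\<exists>(d :: nat) (\<pi> :: (complex \<Rightarrow> complex) \<Rightarrow> complex mat).
    unital_representation d \<pi> \<and> contractive \<pi> \<and> \<not> completely_contractive d \<pi> \<and>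
    (\<exists>F \<in> neil_mats 2. rational_inner F \<and> mat_sup_norm F \<le> 1 \<and>
       op_norm (ampliation d 2 \<pi> F) > 1)"
proof (intro exI conjI)
  show "unital_representation 4 neil_rep" "contractive neil_rep"
    by (rule unital_representation_neil_rep contractive_neil_rep)+
  show "\<not> completely_contractive 4 neil_rep"
    using neil_inner_in_neil_mats mat_sup_norm_neil_inner_le op_norm_ampliation_neil_inner
    unfolding completely_contractive_def by force
  show "\<exists>F\<in>neil_mats 2. rational_inner F \<and> mat_sup_norm F \<le> 1 \<and> op_norm (ampliation 4 2 neil_rep F) > 1"
    using neil_inner_in_neil_mats rational_inner_neil_inner mat_sup_norm_neil_inner_le
      op_norm_ampliation_neil_inner by blast
qed

end
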